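(* Let $\varphi$ be a locally integrable function on $(0,\infty)$ such that $\int_0^\infty\frac{|\log t|}{t}|\varphi(t)|\,dt<\infty$. Then $\mathscr H_\varphi$ is bounded on $\mathcal D(\mathbb C_+)$; moreover, $$\|\mathscr H_\varphi\|_{\mathcal D(\mathbb C_+)\to\mathcal D(\mathbb C_+)}\leq\int_0^\infty\frac{|\varphi(t)|}{t}\,dt.$$
   Context: $\mathbb C_+=\{x+iy\in\mathbb C: y>0\}$ is the upper half-plane. Functions on $(0,\infty)$ are complex-valued. For a measurable function $\varphi$ on $(0,\infty)$, the Hausdorff operator is defined for suitable holomorphic functions $f$ on $\mathbb C_+$ by $\mathscr H_\varphi f(z)=\int_0^\infty f\left(\frac zt\right)\frac{\varphi(t)}{t}\,dt$, $z\in\mathbb C_+$. The Dirichlet space $\mathcal D(\mathbb C_+)$ is the set of all holomorphic functions $f$ on $\mathbb C_+$ with $\|f\|_{\mathcal D(\mathbb C_+)}:=\left(\int_{\mathbb C_+}|f'(x+iy)|^2\,dx\,dy\right)^{1/2}<\infty$, where functions that differ by a constant are identified (which makes $\mathcal D(\mathbb C_+)$ a Hilbert space with this norm). An operator is bounded on a normed space $X$ if it is well-defined on every $f\in X$, maps $X$ into $X$, and has finite operator norm $\|\cdot\|_{X\to X}$. *)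

theory Defs
  imports "HOL-Complex_Analysis.Complex_Analysis"
begin

definition upper_half_plane :: "complex set"
  where "upper_half_plane = {z. 0 < Im z}"

definition locally_integrable_pos :: "(real \<Rightarrow> complex) \<Rightarrow> bool"
  where "locally_integrable_pos \<phi> \<longleftrightarrow>
    (\<forall>K. compact K \<longrightarrow> K \<subseteq> {0<..} \<longrightarrow> set_integrable lebesgue K \<phi>)"

subsection \<open>The Dirichlet space of the upper half-plane\<close>

definition dirichlet_energy :: "(complex \<Rightarrow> complex) \<Rightarrow> ennreal"
  where "dirichlet_energy f =
    (\<integral>\<^sup>+ z\<in>upper_half_plane. ennreal ((cmod (deriv f z))\<^sup>2) \<partial>lborel)"

definition dirichlet_funs :: "(complex \<Rightarrow> complex) set"
  where "dirichlet_funs = {f. f holomorphic_on upper_half_plane \<and> dirichlet_energy f < \<infinity>}"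

definition dirichlet_seminorm :: "(complex \<Rightarrow> complex) \<Rightarrow> real"
  where "dirichlet_seminorm f = sqrt (enn2real (dirichlet_energy f))"

text \<open>
  Besides identifying functions that differ by a constant, this relation makes the values of
  the (total) HOL functions outside the upper half-plane irrelevant.
\<close>
definition dirichlet_rel :: "((complex \<Rightarrow> complex) \<times> (complex \<Rightarrow> complex)) set"
  where "dirichlet_rel = {(f, g). f \<in> dirichlet_funs \<and> g \<in> dirichlet_funs \<and>
    (\<exists>c. \<forall>z\<in>upper_half_plane. f z = g z + c)}"

definition dirichlet_space :: "(complex \<Rightarrow> complex) set set"
  where "dirichlet_space = dirichlet_funs // dirichlet_rel"

text \<open>
  The seminorm is constant on each class (see \<open>dirichlet_norm_class\<close> below), so the
  image of a class is a singleton.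
\<close>
definition dirichlet_norm :: "(complex \<Rightarrow> complex) set \<Rightarrow> real"
  where "dirichlet_norm F = the_elem (dirichlet_seminorm ` F)"

text \<open>The value is \<open>\<infinity>\<close> if no bound exists.\<close>
definition operator_norm_on :: "'a set \<Rightarrow> ('a \<Rightarrow> real) \<Rightarrow> ('a \<Rightarrow> 'a) \<Rightarrow> ennreal"
  where "operator_norm_on X N T =
    Inf {ennreal C |C. 0 \<le> C \<and> (\<forall>F\<in>X. N (T F) \<le> C * N F)}"

subsection \<open>The Hausdorff operator\<close>

definition hausdorff_integrand :: "(real \<Rightarrow> complex) \<Rightarrow> (complex \<Rightarrow> complex) \<Rightarrow> complex \<Rightarrow> real \<Rightarrow> complex"
  where "hausdorff_integrand \<phi> f z t = f (z / of_real t) * (\<phi> t / of_real t)"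

definition hausdorff :: "(real \<Rightarrow> complex) \<Rightarrow> (complex \<Rightarrow> complex) \<Rightarrow> complex \<Rightarrow> complex"
  where "hausdorff \<phi> f z = (LINT t:{0<..}|lebesgue. hausdorff_integrand \<phi> f z t)"

text \<open>
  The induced operator on classes, in the usual union form for functions on a quotient:
  if the class of \<open>hausdorff \<phi> f\<close> does not depend on the representative \<open>f\<close> of \<open>F\<close>,
  the union is that class.
\<close>
definition hausdorff_class :: "(real \<Rightarrow> complex) \<Rightarrow> (complex \<Rightarrow> complex) set \<Rightarrow> (complex \<Rightarrow> complex) set"
  where "hausdorff_class \<phi> F = (\<Union>f\<in>F. dirichlet_rel `` {hausdorff \<phi> f})"

text \<open>
  Well-definedness means that the defining integral converges absolutely at every point and
  that the operator descends to the quotient.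
\<close>
definition hausdorff_well_defined :: "(real \<Rightarrow> complex) \<Rightarrow> bool"
  where "hausdorff_well_defined \<phi> \<longleftrightarrow>
    (\<forall>f\<in>dirichlet_funs. \<forall>z\<in>upper_half_plane.
       set_integrable lebesgue {0<..} (hausdorff_integrand \<phi> f z)) \<and>
    (\<lambda>f. dirichlet_rel `` {hausdorff \<phi> f}) respects dirichlet_rel"

definition hausdorff_bounded :: "(real \<Rightarrow> complex) \<Rightarrow> bool"
  where "hausdorff_bounded \<phi> \<longleftrightarrow>
    hausdorff_well_defined \<phi> \<and>
    hausdorff_class \<phi> \<in> dirichlet_space \<rightarrow> dirichlet_space \<and>
    operator_norm_on dirichlet_space dirichlet_norm (hausdorff_class \<phi>) < \<infinity>"

subsection \<open>Well-definedness of the quotient constructions\<close>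

lemma open_upper_half_plane: "open upper_half_plane"
  unfolding upper_half_plane_def by (rule open_halfspace_Im_gt)

lemma dirichlet_rel_iff:
  "(f, g) \<in> dirichlet_rel \<longleftrightarrow> f \<in> dirichlet_funs \<and> g \<in> dirichlet_funs \<and>
    (\<exists>c. \<forall>z\<in>upper_half_plane. f z = g z + c)"
  by (simp add: dirichlet_rel_def)

lemma equiv_dirichlet_rel: "equiv dirichlet_funs dirichlet_rel"
proof (rule equivI)
  show "dirichlet_rel \<subseteq> dirichlet_funs \<times> dirichlet_funs"
    by (rule subrelI) (simp add: dirichlet_rel_iff)
  show "refl_on dirichlet_funs dirichlet_rel"
  proof (rule refl_onI)
    fix f assume "f \<in> dirichlet_funs"
    moreover have "\<forall>z\<in>upper_half_plane. f z = f z + 0"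
      by simp
    ultimately show "(f, f) \<in> dirichlet_rel"
      unfolding dirichlet_rel_iff by blast
  qed
  show "sym dirichlet_rel"
  proof (rule symI)
    fix f g assume "(f, g) \<in> dirichlet_rel"
    then obtain c where "f \<in> dirichlet_funs" "g \<in> dirichlet_funs"
        and c: "\<forall>z\<in>upper_half_plane. f z = g z + c"
      unfolding dirichlet_rel_iff by blast
    moreover have "\<forall>z\<in>upper_half_plane. g z = f z + (- c)"
      using c by simp
    ultimately show "(g, f) \<in> dirichlet_rel"
      unfolding dirichlet_rel_iff by blast
  qed
  show "trans dirichlet_rel"
  proof (rule transI)
    fix f g h assume "(f, g) \<in> dirichlet_rel" "(g, h) \<in> dirichlet_rel"
    then obtain c d where "f \<in> dirichlet_funs" "h \<in> dirichlet_funs"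
        and c: "\<forall>z\<in>upper_half_plane. f z = g z + c"
        and d: "\<forall>z\<in>upper_half_plane. g z = h z + d"
      unfolding dirichlet_rel_iff by blast
    moreover have "\<forall>z\<in>upper_half_plane. f z = h z + (d + c)"
      using c d by (simp add: add.assoc)
    ultimately show "(f, h) \<in> dirichlet_rel"
      unfolding dirichlet_rel_iff by blast
  qed
qed

lemma dirichlet_seminorm_cong:
  assumes "(f, g) \<in> dirichlet_rel"
  shows "dirichlet_seminorm f = dirichlet_seminorm g"
proof -
  from assms obtain c where g: "g \<in> dirichlet_funs"
      and fg: "\<And>w. w \<in> upper_half_plane \<Longrightarrow> f w = g w + c"
    unfolding dirichlet_rel_iff by blast
  have "deriv f z = deriv g z" if z: "z \<in> upper_half_plane" for z
  proof -
    have "\<forall>\<^sub>F w in nhds z. f w = g w + c"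
      using eventually_nhds_in_open[OF open_upper_half_plane z] by eventually_elim (rule fg)
    then have "deriv f z = deriv (\<lambda>w. g w + c) z"
      by (rule deriv_cong_ev) simp
    also have "\<dots> = deriv g z"
      using g holomorphic_on_imp_differentiable_at[OF _ open_upper_half_plane z]
      by (simp add: dirichlet_funs_def)
    finally show ?thesis .
  qed
  then have "dirichlet_energy f = dirichlet_energy g"
    unfolding dirichlet_energy_def by (intro nn_integral_cong) (simp split: split_indicator)
  then show ?thesis
    by (simp add: dirichlet_seminorm_def)
qed

lemma dirichlet_norm_class:
  assumes "f \<in> dirichlet_funs"
  shows "dirichlet_norm (dirichlet_rel `` {f}) = dirichlet_seminorm f"
proof -
  have "dirichlet_seminorm g = dirichlet_seminorm f" if "g \<in> dirichlet_rel `` {f}" for g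
    using that dirichlet_seminorm_cong[of f g] by simp
  moreover have "f \<in> dirichlet_rel `` {f}"
    using equiv_dirichlet_rel assms by (rule equiv_class_self)
  ultimately have "dirichlet_seminorm ` (dirichlet_rel `` {f}) = {dirichlet_seminorm f}"
    by blast
  then show ?thesis
    by (simp add: dirichlet_norm_def)
qed

lemma hausdorff_class_class:
  assumes "hausdorff_well_defined \<phi>" "f \<in> dirichlet_funs"
  shows "hausdorff_class \<phi> (dirichlet_rel `` {f}) = dirichlet_rel `` {hausdorff \<phi> f}"
proof -
  have "(\<lambda>f. dirichlet_rel `` {hausdorff \<phi> f}) respects dirichlet_rel"
    using assms(1) unfolding hausdorff_well_defined_def by (rule conjunct2)
  from UN_equiv_class[OF equiv_dirichlet_rel this assms(2)] show ?thesis
    unfolding hausdorff_class_def .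
qed

end

theory Submission
  imports Defs
begin

text \<open>
  Averaging Cauchy's formula over circles shows that \<open>\<bar>f'(z)\<bar> \<le> C / Im z\<close> for \<open>f\<close> in the
  Dirichlet space. Hence \<open>\<bar>f(z/t) - f(z)\<bar>\<close> is at most a multiple of \<open>\<bar>ln t\<bar>\<close>, so the Hausdorff
  integral converges absolutely, and \<open>f\<close> is Lipschitz away from the boundary, so it may be
  differentiated under the integral sign. The Cauchy--Schwarz inequality for the measure
  \<open>\<bar>\<phi>(t)\<bar> dt / t\<close>, Tonelli's theorem and the invariance of the Dirichlet integral under the
  dilations \<open>z \<mapsto> z/t\<close> then give the norm bound.
\<close>

subsection \<open>The area mean value inequality\<close>

lemma nn_integral_lborel_translate:
  fixes f :: "'a::euclidean_space \<Rightarrow> ennreal"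
  assumes [measurable]: "f \<in> borel_measurable borel"
  shows "(\<integral>\<^sup>+x. f (a + x) \<partial>lborel) = (\<integral>\<^sup>+x. f x \<partial>lborel)"
  by (subst lborel_distr_plus[of a, symmetric]) (simp add: nn_integral_distr)

lemma nn_integral_lborel_scale:
  fixes f :: "'a::euclidean_space \<Rightarrow> ennreal"
  assumes [measurable]: "f \<in> borel_measurable borel" and c: "c \<noteq> 0"
  shows "(\<integral>\<^sup>+x. f x \<partial>lborel) = ennreal (\<bar>c\<bar> ^ DIM('a)) * (\<integral>\<^sup>+x. f (c *\<^sub>R x) \<partial>lborel)"
  by (subst lborel_affine[OF c, of 0])
     (simp add: nn_integral_density nn_integral_distr nn_integral_cmult)

text \<open>
  The classical uniqueness argument for Haar measure: integrate \<open>f x\<close> against the indicator of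
  \<open>c * y - x \<in> ball 0 1\<close> in both orders.
\<close>
lemma nn_integral_lborel_rotate:
  fixes f :: "complex \<Rightarrow> ennreal"
  assumes [measurable]: "f \<in> borel_measurable borel" and c: "cmod c = 1"
  shows "(\<integral>\<^sup>+x. f (c * x) \<partial>lborel) = (\<integral>\<^sup>+x. f x \<partial>lborel)"
proof -
  define B :: "complex \<Rightarrow> ennreal" where "B = indicator (ball 0 1)"
  have [measurable]: "B \<in> borel_measurable borel"
    unfolding B_def by (intro borel_measurable_indicator) simp
  have c0: "c \<noteq> 0" using c by auto
  have Bc: "B (c * y) = B y" "B (y * c) = B y" "B (- y) = B y" for y
    using c by (simp_all add: B_def norm_mult indicator_def)
  define \<beta> where "\<beta> = (\<integral>\<^sup>+y. B y \<partial>lborel)"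
  \<comment> \<open>The value matters only at the end, where \<open>\<beta>\<close>, neither zero
    nor infinite, is cancelled.\<close>
  have \<beta>: "\<beta> = ennreal pi"
    by (simp add: \<beta>_def B_def emeasure_ball unit_ball_vol_2)
  have "\<beta> * (\<integral>\<^sup>+x. f x \<partial>lborel) = (\<integral>\<^sup>+x. f x * (\<integral>\<^sup>+y. B (c * y) \<partial>lborel) \<partial>lborel)"
    by (simp add: Bc \<beta>_def nn_integral_multc mult.commute[of "nn_integral lborel B"])
  \<comment> \<open>For fixed \<open>x\<close>, shifting \<open>y\<close> by
    \<open>- (x / c)\<close> leaves the integral unchanged and produces the coupling
    \<open>c * y - x\<close>.\<close>
  also have "\<dots> = (\<integral>\<^sup>+x. f x * (\<integral>\<^sup>+y. B (c * (- (x / c) + y)) \<partial>lborel) \<partial>lborel)"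
    by (subst nn_integral_lborel_translate) simp_all
  also have "\<dots> = (\<integral>\<^sup>+x. (\<integral>\<^sup>+y. f x * B (c * y - x) \<partial>lborel) \<partial>lborel)"
    using c0 by (simp add: nn_integral_cmult algebra_simps)
  also have "\<dots> = (\<integral>\<^sup>+y. (\<integral>\<^sup>+x. f x * B (c * y - x) \<partial>lborel) \<partial>lborel)"
    by (rule lborel_pair.Fubini') measurable
  \<comment> \<open>For fixed \<open>y\<close>, shifting \<open>x\<close> by \<open>c * y\<close>
    undoes the coupling: the disc indicator no longer sees \<open>y\<close>, so the
    \<open>y\<close>-integral can be taken first.\<close>
  also have "\<dots> = (\<integral>\<^sup>+y. (\<integral>\<^sup>+x. f (c * y + x) * B (c * y - (c * y + x)) \<partial>lborel) \<partial>lborel)"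
    by (subst nn_integral_lborel_translate[where f = "\<lambda>x. f x * B (c * _ - x)"]) simp_all
  also have "\<dots> = (\<integral>\<^sup>+y. (\<integral>\<^sup>+x. f (c * y + x) * B x \<partial>lborel) \<partial>lborel)"
    by (simp add: Bc)
  also have "\<dots> = (\<integral>\<^sup>+x. (\<integral>\<^sup>+y. f (c * y + x) * B x \<partial>lborel) \<partial>lborel)"
    by (rule lborel_pair.Fubini') measurable
  also have "\<dots> = (\<integral>\<^sup>+x. (\<integral>\<^sup>+y. f (c * (x / c + y)) \<partial>lborel) * B x \<partial>lborel)"
    using c0 by (simp add: nn_integral_multc distrib_left add.commute)
  also have "\<dots> = (\<integral>\<^sup>+x. (\<integral>\<^sup>+y. f (c * y) \<partial>lborel) * B x \<partial>lborel)"
    by (subst nn_integral_lborel_translate) simp_all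
  also have "\<dots> = \<beta> * (\<integral>\<^sup>+y. f (c * y) \<partial>lborel)"
    by (subst nn_integral_cmult) (simp_all add: \<beta>_def mult.commute)
  finally show ?thesis
    unfolding \<beta> by (simp add: ennreal_mult_cancel_left)
qed

text \<open>Cauchy's formula at the centre, followed by the triangle inequality for integrals. The
  nonnegative extended integral is the form in which Tonelli's theorem applies later.\<close>

lemma norm_le_circle_mean:
  assumes G: "G holomorphic_on cball 0 1"
  shows "ennreal (cmod (G 0)) \<le> (\<integral>\<^sup>+x\<in>{0..1}. ennreal (cmod (G (exp (2 * of_real pi * \<i> * of_real x)))) \<partial>lborel)"
proof -
  define e where "e x = exp (2 * of_real pi * \<i> * of_real x)" for x :: real
  have e1: "cmod (e x) = 1" for x
    by (simp add: e_def)
  have "((\<lambda>u. G u / (u - 0)) has_contour_integral (2 * of_real pi * \<i> * G 0)) (circlepath 0 1)"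
    by (rule Cauchy_integral_circlepath_simple[OF G]) simp
  \<comment> \<open>With \<open>u = e x\<close> one has \<open>u' = 2 * pi * \<i> * u\<close>, so
    the denominator \<open>u\<close> of the Cauchy kernel cancels.\<close>
  then have "((\<lambda>x. 2 * of_real pi * \<i> * G (e x)) has_integral (2 * of_real pi * \<i> * G 0)) {0..1}"
    unfolding has_contour_integral_def
    by (rule has_integral_eq[rotated])
       (subst vector_derivative_circlepath01, auto simp: circlepath e_def)
  from has_integral_mult_right[OF this, of "1 / (2 * of_real pi * \<i>)"]
  have I: "((\<lambda>x. G (e x)) has_integral G 0) {0..1}"
    by (simp add: field_simps)
  have cont: "continuous_on {0..1} (\<lambda>x. cmod (G (e x)))"
    by (intro continuous_intros continuous_on_compose2[OF holomorphic_on_imp_continuous_on[OF G]])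
       (auto simp: e_def intro!: continuous_intros)
  define J where "J = integral {0..1} (\<lambda>x. cmod (G (e x)))"
  have J: "((\<lambda>x. cmod (G (e x))) has_integral J) {0..1}"
    unfolding J_def by (intro integrable_integral integrable_continuous_interval cont)
  have "cmod (G 0) \<le> J"
    using integral_norm_bound_integral[OF has_integral_integrable[OF I] has_integral_integrable[OF J]]
    by (simp add: integral_unique[OF I] integral_unique[OF J])
  moreover have "(\<integral>\<^sup>+x\<in>{0..1}. ennreal (cmod (G (e x))) \<partial>lborel) = ennreal J"
    by (rule nn_integral_has_integral_lebesgue'[OF _ J]) simp
  ultimately show ?thesis
    unfolding e_def by (simp add: ennreal_leI)
qed

text \<open>Rotations replace polar coordinates: every \<open>w\<close> in the disc carries the
  circle \<open>z + e x * w\<close>. The circle inequality is integrated over all \<open>w\<close>;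
  after exchanging the integrals, rotation invariance makes the inner one independent of
  \<open>x\<close>.\<close>

lemma norm_le_area_mean:
  assumes h: "h holomorphic_on ball z r" and r: "0 < r"
  shows "ennreal (pi * r\<^sup>2) * ennreal (cmod (h z)) \<le> (\<integral>\<^sup>+w\<in>ball z r. ennreal (cmod (h w)) \<partial>lborel)"
proof -
  define e where "e x = exp (2 * of_real pi * \<i> * of_real x)" for x :: real
  have e1: "cmod (e x) = 1" for x
    by (simp add: e_def)
  have [measurable]: "e \<in> borel_measurable borel"
    unfolding e_def by (intro borel_measurable_continuous_onI continuous_intros)
  \<comment> \<open>Extension by zero makes the integrand Borel on the whole plane, where
    translation and rotation invariance are available.\<close>
  define K where "K w = ennreal (cmod (h w)) * indicator (ball z r) w" for w
  have K_eq: "K = (\<lambda>w. ennreal (cmod (indicator (ball z r) w *\<^sub>R h w)))"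
    by (auto simp: K_def fun_eq_iff indicator_def)
  have [measurable]: "(\<lambda>w. indicator (ball z r) w *\<^sub>R h w) \<in> borel_measurable borel"
    by (intro borel_measurable_continuous_on_indicator holomorphic_on_imp_continuous_on h) simp
  have [measurable]: "K \<in> borel_measurable borel"
    unfolding K_eq by measurable
  have mean: "ennreal (cmod (h z)) * indicator (ball 0 r) w
      \<le> (\<integral>\<^sup>+x. K (z + e x * w) * indicator {0..1} x \<partial>lborel)" for w
  proof (cases "w \<in> ball 0 r")
    case True
    have sub: "(\<lambda>u. z + u * w) ` cball 0 1 \<subseteq> ball z r"
    proof safe
      fix u :: complex assume "u \<in> cball 0 1"
      then have "cmod u * cmod w \<le> 1 * cmod w"
        by (intro mult_right_mono) auto
      then show "z + u * w \<in> ball z r"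
        using True by (simp add: dist_norm norm_mult)
    qed
    have "(\<lambda>u. h (z + u * w)) holomorphic_on cball 0 1"
      using holomorphic_on_compose_gen[OF _ h sub]
      by (simp add: o_def holomorphic_intros)
    from norm_le_circle_mean[OF this]
    have "ennreal (cmod (h z)) \<le> (\<integral>\<^sup>+x\<in>{0..1}. ennreal (cmod (h (z + e x * w))) \<partial>lborel)"
      by (simp add: e_def)
    also have "\<dots> = (\<integral>\<^sup>+x. K (z + e x * w) * indicator {0..1} x \<partial>lborel)"
      using True by (intro nn_integral_cong) (simp add: K_def dist_norm norm_mult e1)
    finally show ?thesis
      using True by simp
  qed simp
  have "(\<integral>\<^sup>+w. ennreal (cmod (h z)) * indicator (ball 0 r) (w::complex) \<partial>lborel)
      \<le> (\<integral>\<^sup>+w. \<integral>\<^sup>+x. K (z + e x * w) * indicator {0..1} x \<partial>lborel \<partial>lborel)"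
    by (intro nn_integral_mono mean)
  also have "\<dots> = (\<integral>\<^sup>+x. \<integral>\<^sup>+w. K (z + e x * w) * indicator {0..1::real} x \<partial>lborel \<partial>lborel)"
    by (rule lborel_pair.Fubini') measurable
  also have "\<dots> = (\<integral>\<^sup>+x. (\<integral>\<^sup>+w. K (z + e x * w) \<partial>lborel) * indicator {0..1::real} x \<partial>lborel)"
    by (simp add: nn_integral_multc)
  also have "\<dots> = (\<integral>\<^sup>+x. (\<integral>\<^sup>+w. K w \<partial>lborel) * indicator {0..1::real} x \<partial>lborel)"
    by (simp add: nn_integral_lborel_rotate[OF _ e1, of "\<lambda>w. K (z + w)"] nn_integral_lborel_translate)
  also have "\<dots> = (\<integral>\<^sup>+w. K w \<partial>lborel)"
    by (simp add: nn_integral_cmult)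
  also have "(\<integral>\<^sup>+w. ennreal (cmod (h z)) * indicator (ball 0 r) (w::complex) \<partial>lborel)
      = ennreal (pi * r\<^sup>2) * ennreal (cmod (h z))"
    using r by (subst nn_integral_cmult_indicator)
      (simp_all add: emeasure_ball unit_ball_vol_2 mult.commute)
  finally show ?thesis
    by (simp add: K_def)
qed

subsection \<open>Pointwise estimates in the Dirichlet space\<close>

text \<open>Subharmonicity of \<open>\<bar>f'\<bar>\<^sup>2\<close> on the largest disc around \<open>z\<close> inside the half-plane.\<close>
lemma dirichlet_deriv_bound:
  assumes f: "f \<in> dirichlet_funs" and z: "z \<in> upper_half_plane"
  shows "cmod (deriv f z) \<le> dirichlet_seminorm f / Im z"
proof -
  have y: "0 < Im z"
    using z by (simp add: upper_half_plane_def)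
  have fin: "dirichlet_energy f < \<infinity>" and hol: "f holomorphic_on upper_half_plane"
    using f by (auto simp: dirichlet_funs_def)
  have sub: "ball z (Im z) \<subseteq> upper_half_plane"
  proof
    fix w assume "w \<in> ball z (Im z)"
    then have "\<bar>Im (z - w)\<bar> < Im z"
      using abs_Im_le_cmod[of "z - w"] by (simp add: dist_norm)
    then show "w \<in> upper_half_plane"
      by (simp add: upper_half_plane_def)
  qed
  \<comment> \<open>The square is itself holomorphic, and its modulus is the energy density, so the
    area inequality bounds it directly by the energy.\<close>
  have "(\<lambda>w. (deriv f w)\<^sup>2) holomorphic_on ball z (Im z)"
    by (intro holomorphic_on_power holomorphic_on_subset[OF _ sub]
        holomorphic_deriv[OF hol open_upper_half_plane])
  from norm_le_area_mean[OF this y]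
  have "ennreal (pi * (Im z)\<^sup>2) * ennreal (cmod ((deriv f z)\<^sup>2))
      \<le> (\<integral>\<^sup>+w\<in>ball z (Im z). ennreal (cmod ((deriv f w)\<^sup>2)) \<partial>lborel)" .
  also have "\<dots> \<le> dirichlet_energy f"
    unfolding dirichlet_energy_def norm_power
    using sub by (intro nn_integral_mono) (auto simp: indicator_def)
  also have "\<dots> = ennreal (enn2real (dirichlet_energy f))"
    using fin by simp
  finally have "pi * (Im z)\<^sup>2 * (cmod (deriv f z))\<^sup>2 \<le> enn2real (dirichlet_energy f)"
    by (simp add: ennreal_mult[symmetric] norm_power)
  \<comment> \<open>The factor pi is weakened to 1. The estimate only serves integrability and
    domination, so its constant does not enter the final norm bound.\<close>
  moreover have "1 * ((Im z)\<^sup>2 * (cmod (deriv f z))\<^sup>2) \<le> pi * ((Im z)\<^sup>2 * (cmod (deriv f z))\<^sup>2)"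
    using pi_ge_two by (intro mult_right_mono) auto
  ultimately have "(Im z * cmod (deriv f z))\<^sup>2 \<le> enn2real (dirichlet_energy f)"
    by (simp add: power_mult_distrib mult.assoc)
  then have "Im z * cmod (deriv f z) \<le> dirichlet_seminorm f"
    unfolding dirichlet_seminorm_def by (rule real_le_rsqrt)
  then show ?thesis
    using y by (simp add: field_simps)
qed

text \<open>On the convex set of points of height at least \<open>\<eta>\<close> the derivative
  bound is uniform, so the mean value inequality applies. This will dominate difference
  quotients.\<close>

lemma dirichlet_lipschitz:
  assumes f: "f \<in> dirichlet_funs" and \<eta>: "0 < \<eta>" "\<eta> \<le> Im a" "\<eta> \<le> Im b"
  shows "cmod (f a - f b) \<le> dirichlet_seminorm f / \<eta> * cmod (a - b)"
proof (rule field_differentiable_bound)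
  have hol: "f holomorphic_on upper_half_plane"
    using f by (auto simp: dirichlet_funs_def)
  have S: "{z. \<eta> \<le> Im z} \<subseteq> upper_half_plane"
    using \<eta> by (auto simp: upper_half_plane_def)
  show "convex {z. \<eta> \<le> Im z}"
    using convex_halfspace_Im_ge[of \<eta>] by simp
  show "(f has_field_derivative deriv f z) (at z within {z. \<eta> \<le> Im z})" if "z \<in> {z. \<eta> \<le> Im z}" for z
    using that S holomorphic_derivI[OF hol open_upper_half_plane] by blast
  show "cmod (deriv f z) \<le> dirichlet_seminorm f / \<eta>" if z: "z \<in> {z. \<eta> \<le> Im z}" for z
  proof -
    have "cmod (deriv f z) \<le> dirichlet_seminorm f / Im z"
      using z S by (intro dirichlet_deriv_bound f) blast
    also have "\<dots> \<le> dirichlet_seminorm f / \<eta>"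
      using z \<eta> by (intro divide_left_mono) (auto simp: dirichlet_seminorm_def)
    finally show ?thesis .
  qed
qed (use \<eta> in auto)

text \<open>This is the source of the logarithmic weight. Along the ray \<open>z * exp (- s)\<close>
  the derivative bound grows like \<open>exp s\<close> while the speed decays like
  \<open>exp (- s)\<close>; the product is constant in the variable \<open>s = ln t\<close>.\<close>

lemma dirichlet_dilation_bound:
  assumes f: "f \<in> dirichlet_funs" and z: "z \<in> upper_half_plane" and t: "0 < t"
  shows "cmod (f (z / of_real t)) \<le> cmod (f z) + dirichlet_seminorm f * cmod z / Im z * \<bar>ln t\<bar>"
proof -
  have hol: "f holomorphic_on upper_half_plane"
    using f by (auto simp: dirichlet_funs_def)
  have y: "0 < Im z"
    using z by (simp add: upper_half_plane_def)
  define L where "L = dirichlet_seminorm f * cmod z / Im z"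
  \<comment> \<open>The mean value inequality is applied on the real axis, viewed as a convex subset
    of the complex plane, between \<open>0\<close> and \<open>ln t\<close>.\<close>
  have "cmod (f (z * exp (- of_real (ln t))) - f (z * exp (- 0))) \<le> L * cmod (of_real (ln t) - 0)"
  proof (rule field_differentiable_bound[where S = \<real> and f = "\<lambda>u. f (z * exp (- u))"
        and f' = "\<lambda>u. deriv f (z * exp (- u)) * (z * exp (- u) * (- 1))"])
    fix u :: complex assume "u \<in> \<real>"
    then obtain s where u: "u = of_real s"
      by (auto elim: Reals_cases)
    have e: "exp (- u) = of_real (exp (- s))"
      by (simp add: u exp_of_real[symmetric])
    have U: "z * exp (- u) \<in> upper_half_plane"
      using y by (simp add: e upper_half_plane_def)
    have "(f has_field_derivative deriv f (z * exp (- u))) (at (z * exp (- u)))"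
      by (rule holomorphic_derivI[OF hol open_upper_half_plane U])
    moreover have "((\<lambda>u. z * exp (- u)) has_field_derivative z * exp (- u) * (- 1)) (at u within \<real>)"
      by (auto intro!: derivative_eq_intros)
    ultimately show "((\<lambda>u. f (z * exp (- u))) has_field_derivative
        deriv f (z * exp (- u)) * (z * exp (- u) * (- 1))) (at u within \<real>)"
      by (rule DERIV_chain2)
    have "cmod (deriv f (z * exp (- u))) \<le> dirichlet_seminorm f / Im (z * exp (- u))"
      by (rule dirichlet_deriv_bound[OF f U])
    then have "cmod (deriv f (z * exp (- u))) * (cmod z * exp (- s))
        \<le> dirichlet_seminorm f / (Im z * exp (- s)) * (cmod z * exp (- s))"
      by (intro mult_right_mono) (auto simp: e)
    then show "cmod (deriv f (z * exp (- u)) * (z * exp (- u) * (- 1))) \<le> L"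
      by (simp add: norm_mult e L_def)
  qed (auto simp: convex_Reals)
  moreover have "z * exp (- of_real (ln t)) = z / of_real t"
    using t by (simp add: exp_minus exp_of_real divide_inverse)
  ultimately have "cmod (f (z / of_real t) - f z) \<le> L * \<bar>ln t\<bar>"
    by simp
  then show ?thesis
    using norm_triangle_ineq2[of "f (z / of_real t)" "f z"] unfolding L_def by linarith
qed

subsection \<open>Averages of dilations against a Borel kernel\<close>

text \<open>
  The kernel \<open>k\<close> is a Borel version of \<open>\<phi>(t)/t\<close>, and \<open>F\<close>, \<open>D\<close> extend \<open>f\<close>, \<open>f'\<close> by zero, so that
  all integrands below are Borel measurable on the whole space.
\<close>
locale dirichlet_dilation =
  fixes k :: "real \<Rightarrow> complex" and f :: "complex \<Rightarrow> complex"
  assumes k_integrable: "integrable lborel k"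
    and ln_k_integrable: "integrable lborel (\<lambda>t. of_real (ln t) * k t)"
    and k_nonpos: "\<And>t. t \<le> 0 \<Longrightarrow> k t = 0"
    and f_dirichlet: "f \<in> dirichlet_funs"
begin

definition F :: "complex \<Rightarrow> complex"
  where "F z = indicator upper_half_plane z *\<^sub>R f z"

definition D :: "complex \<Rightarrow> complex"
  where "D z = indicator upper_half_plane z *\<^sub>R deriv f z"

definition H :: "complex \<Rightarrow> complex"
  where "H z = (\<integral>t. F (z / of_real t) * k t \<partial>lborel)"

text \<open>The candidate for the derivative of \<open>H\<close>: \<open>D (z / t) / t\<close> is
  the derivative of the dilate \<open>f (z / t)\<close> with respect to \<open>z\<close>.\<close>

definition H' :: "complex \<Rightarrow> complex"
  where "H' z = (\<integral>t. D (z / of_real t) / of_real t * k t \<partial>lborel)"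

lemma f_holomorphic: "f holomorphic_on upper_half_plane"
  using f_dirichlet by (simp add: dirichlet_funs_def)

lemma k_measurable [measurable]: "k \<in> borel_measurable borel"
  using borel_measurable_integrable[OF k_integrable] by simp

lemma F_measurable [measurable]: "F \<in> borel_measurable borel"
  unfolding F_def
  by (intro borel_measurable_continuous_on_indicator holomorphic_on_imp_continuous_on f_holomorphic
      borel_open open_upper_half_plane)

lemma D_measurable [measurable]: "D \<in> borel_measurable borel"
  unfolding D_def
  by (intro borel_measurable_continuous_on_indicator holomorphic_on_imp_continuous_on
      holomorphic_deriv f_holomorphic borel_open open_upper_half_plane)

lemma divide_in_upper_half_plane:
  "z \<in> upper_half_plane \<Longrightarrow> 0 < t \<Longrightarrow> z / of_real t \<in> upper_half_plane"
  by (simp add: upper_half_plane_def)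

text \<open>The dilation bound splits the majorant into a multiple of \<open>\<bar>k\<bar>\<close>
  and a multiple of \<open>\<bar>ln t * k\<bar>\<close>, both integrable by the locale
  assumptions.\<close>

lemma integrable_F:
  assumes z: "z \<in> upper_half_plane"
  shows "integrable lborel (\<lambda>t. F (z / of_real t) * k t)"
proof (rule Bochner_Integration.integrable_bound)
  define L where "L = dirichlet_seminorm f * cmod z / Im z"
  show "integrable lborel (\<lambda>t. cmod (f z) * cmod (k t) + L * cmod (of_real (ln t) * k t))"
    by (intro Bochner_Integration.integrable_add integrable_mult_right integrable_norm
        k_integrable ln_k_integrable)
  show "AE t in lborel. cmod (F (z / of_real t) * k t)
      \<le> norm (cmod (f z) * cmod (k t) + L * cmod (of_real (ln t) * k t))"
  proof (rule AE_I2)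
    fix t :: real
    show "cmod (F (z / of_real t) * k t) \<le> norm (cmod (f z) * cmod (k t) + L * cmod (of_real (ln t) * k t))"
    proof (cases "0 < t")
      case True
      have "cmod (F (z / of_real t)) * cmod (k t) \<le> (cmod (f z) + L * \<bar>ln t\<bar>) * cmod (k t)"
        using dirichlet_dilation_bound[OF f_dirichlet z True] divide_in_upper_half_plane[OF z True]
        by (intro mult_right_mono) (simp_all add: F_def L_def)
      then show ?thesis
        by (simp add: norm_mult algebra_simps)
    qed (simp add: k_nonpos)
  qed
qed measurable

text \<open>Dominated convergence for difference quotients. The majorant is a multiple of
  \<open>\<bar>k\<bar>\<close>, because the dilation by \<open>1 / t\<close> multiplies the
  Lipschitz constant by \<open>t\<close> and distances by \<open>1 / t\<close>.\<close>

lemma H_has_derivative: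
  assumes z: "z \<in> upper_half_plane"
  shows "(H has_field_derivative H' z) (at z)"
proof -
  \<comment> \<open>Half the height of \<open>z\<close> gives an open half-plane around
    \<open>z\<close> that stays away from the boundary.\<close>
  define \<eta> where "\<eta> = Im z / 2"
  have \<eta>: "0 < \<eta>" "\<eta> < Im z"
    using z by (simp_all add: \<eta>_def upper_half_plane_def)
  define S where "S = {w. \<eta> < Im w}"
  have "open S"
    unfolding S_def by (rule open_halfspace_Im_gt)
  have "z \<in> S"
    using \<eta> by (simp add: S_def)
  have SU: "S \<subseteq> upper_half_plane"
    using \<eta> by (auto simp: S_def upper_half_plane_def)
  have "((\<lambda>w. (H w - H z) / (w - z)) \<longlongrightarrow> H' z) (at z within S)"
    \<comment> \<open>Dominated convergence is used for sequences, so the limit is tested along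
      arbitrary sequences in \<open>S - {z}\<close>.\<close>
    unfolding tendsto_at_iff_sequentially
  proof (intro allI impI)
    fix X :: "nat \<Rightarrow> complex" assume X: "\<forall>i. X i \<in> S - {z}" and lim: "X \<longlonglongrightarrow> z"
    define s where "s n t = (F (X n / of_real t) - F (z / of_real t)) / (X n - z) * k t" for n t
    have "(\<lambda>n. \<integral>t. s n t \<partial>lborel) \<longlonglongrightarrow> H' z"
      unfolding H'_def
    proof (rule integral_dominated_convergence[where w = "\<lambda>t. dirichlet_seminorm f / \<eta> * cmod (k t)"])
      show "integrable lborel (\<lambda>t. dirichlet_seminorm f / \<eta> * cmod (k t))"
        by (intro integrable_mult_right integrable_norm k_integrable)
      show "AE t in lborel. (\<lambda>n. s n t) \<longlonglongrightarrow> D (z / of_real t) / of_real t * k t"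
      proof (rule AE_I2)
        fix t :: real
        show "(\<lambda>n. s n t) \<longlonglongrightarrow> D (z / of_real t) / of_real t * k t"
        proof (cases "0 < t")
          case True
          have "(f has_field_derivative deriv f (z / of_real t)) (at (z / of_real t))"
            by (rule holomorphic_derivI[OF f_holomorphic open_upper_half_plane
                  divide_in_upper_half_plane[OF z True]])
          moreover have "((\<lambda>w. w / of_real t) has_field_derivative 1 / of_real t) (at z within S)"
            using True by (auto intro!: derivative_eq_intros)
          ultimately have "((\<lambda>w. f (w / of_real t)) has_field_derivative
              deriv f (z / of_real t) * (1 / of_real t)) (at z within S)"
            by (rule DERIV_chain2)
          then have "((\<lambda>w. (f (w / of_real t) - f (z / of_real t)) / (w - z)) \<longlongrightarrow>
              deriv f (z / of_real t) * (1 / of_real t)) (at z within S)"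
            by (simp add: has_field_derivative_iff)
          then have "(\<lambda>n. (f (X n / of_real t) - f (z / of_real t)) / (X n - z)) \<longlonglongrightarrow>
              deriv f (z / of_real t) * (1 / of_real t)"
            using X lim unfolding tendsto_at_iff_sequentially by (auto simp: o_def)
          from tendsto_mult_right[OF this, of "k t"] show ?thesis
            using X SU divide_in_upper_half_plane[OF _ True] z
            by (simp add: s_def F_def D_def subset_iff)
        qed (simp add: s_def k_nonpos)
      qed
      show "AE t in lborel. cmod (s n t) \<le> dirichlet_seminorm f / \<eta> * cmod (k t)" for n
      proof (rule AE_I2)
        fix t :: real
        show "cmod (s n t) \<le> dirichlet_seminorm f / \<eta> * cmod (k t)"
        proof (cases "0 < t")
          case True
          have "X n \<in> S" "X n \<noteq> z" "X n \<in> upper_half_plane"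
            using X SU by auto
          have "cmod (f (X n / of_real t) - f (z / of_real t))
              \<le> dirichlet_seminorm f / (\<eta> / t) * cmod (X n / of_real t - z / of_real t)"
            using True \<eta> \<open>X n \<in> S\<close> \<open>z \<in> S\<close>
            by (intro dirichlet_lipschitz f_dirichlet) (auto simp: S_def divide_right_mono)
          also have "\<dots> = dirichlet_seminorm f / \<eta> * cmod (X n - z)"
            using True by (simp add: diff_divide_distrib[symmetric] norm_divide)
          finally have "cmod (f (X n / of_real t) - f (z / of_real t)) / cmod (X n - z)
              \<le> dirichlet_seminorm f / \<eta>"
            using \<open>X n \<noteq> z\<close> by (simp add: pos_divide_le_eq)
          then have "cmod (f (X n / of_real t) - f (z / of_real t)) / cmod (X n - z) * cmod (k t)
              \<le> dirichlet_seminorm f / \<eta> * cmod (k t)"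
            by (rule mult_right_mono) simp
          then show ?thesis
            using divide_in_upper_half_plane[OF _ True] z \<open>X n \<in> upper_half_plane\<close>
            by (simp add: s_def F_def norm_mult norm_divide)
        qed (simp add: s_def k_nonpos)
      qed
    qed (unfold s_def, measurable)
    moreover have "(\<integral>t. s n t \<partial>lborel) = (H (X n) - H z) / (X n - z)" for n
    proof -
      have "X n \<in> upper_half_plane"
        using X SU by auto
      then have "H (X n) - H z = (\<integral>t. F (X n / of_real t) * k t - F (z / of_real t) * k t \<partial>lborel)"
        unfolding H_def by (intro Bochner_Integration.integral_diff[symmetric] integrable_F z)
      then have "(H (X n) - H z) / (X n - z)
          = (\<integral>t. (F (X n / of_real t) * k t - F (z / of_real t) * k t) / (X n - z) \<partial>lborel)"
        by simp
      also have "\<dots> = (\<integral>t. s n t \<partial>lborel)"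
        by (intro Bochner_Integration.integral_cong) (simp_all add: s_def algebra_simps)
      finally show ?thesis ..
    qed
    ultimately show "((\<lambda>w. (H w - H z) / (w - z)) \<circ> X) \<longlonglongrightarrow> H' z"
      by (simp add: o_def)
  qed
  then show ?thesis
    using at_within_open[OF \<open>z \<in> S\<close> \<open>open S\<close>] by (simp add: has_field_derivative_iff)
qed

text \<open>In real dimension two the Jacobian \<open>t\<^sup>2\<close> cancels exactly the squared
  chain-rule factor \<open>1 / t\<^sup>2\<close>.\<close>

lemma dilated_energy:
  assumes t: "0 < t"
  shows "(\<integral>\<^sup>+z. ennreal ((cmod (D (z / of_real t) / of_real t))\<^sup>2) \<partial>lborel) = dirichlet_energy f"
proof -
  have "(\<integral>\<^sup>+z. ennreal ((cmod (D (z / of_real t) / of_real t))\<^sup>2) \<partial>lborel)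
      = ennreal (t\<^sup>2) * (\<integral>\<^sup>+z. ennreal ((cmod (D z))\<^sup>2 / t\<^sup>2) \<partial>lborel)"
    using t by (subst nn_integral_lborel_scale[where c = t])
      (simp_all add: norm_divide power_divide scaleR_conv_of_real)
  also have "\<dots> = (\<integral>\<^sup>+z. ennreal (t\<^sup>2) * ennreal ((cmod (D z))\<^sup>2 / t\<^sup>2) \<partial>lborel)"
    by (rule nn_integral_cmult[symmetric]) measurable
  also have "\<dots> = dirichlet_energy f"
    unfolding dirichlet_energy_def
    using t by (intro nn_integral_cong) (simp add: ennreal_mult[symmetric] D_def indicator_def)
  finally show ?thesis .
qed

text \<open>Cauchy-Schwarz with \<open>\<bar>k\<bar>\<close> split into two square roots, one of
  which stays with the dilated derivative.\<close>

lemma norm_H'_le: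
  "ennreal ((cmod (H' z))\<^sup>2) \<le>
    (\<integral>\<^sup>+t. ennreal (cmod (k t)) * ennreal ((cmod (D (z / of_real t) / of_real t))\<^sup>2) \<partial>lborel)
    * (\<integral>\<^sup>+t. ennreal (cmod (k t)) \<partial>lborel)"
proof -
  define a b where "a t = ennreal (sqrt (cmod (k t)) * cmod (D (z / of_real t) / of_real t))"
    and "b t = ennreal (sqrt (cmod (k t)))" for t
  have sqrt2: "sqrt (cmod c) * (sqrt (cmod c) * y) = cmod c * y" for c y
    by (simp add: mult.assoc[symmetric])
  have ab: "a t * b t = ennreal (cmod (D (z / of_real t) / of_real t * k t))" for t
    by (simp add: a_def b_def ennreal_mult[symmetric] norm_mult norm_divide mult_ac sqrt2)
  have a2: "(a t)\<^sup>2 = ennreal (cmod (k t)) * ennreal ((cmod (D (z / of_real t) / of_real t))\<^sup>2)"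
    and b2: "(b t)\<^sup>2 = ennreal (cmod (k t))" for t
    unfolding a_def b_def
    by (simp_all add: ennreal_power ennreal_mult[symmetric] power_mult_distrib)
  have "ennreal (cmod (H' z)) \<le> (\<integral>\<^sup>+t. a t * b t \<partial>lborel)"
  \<comment> \<open>If the integrand is not integrable, \<open>H' z\<close> has the default value 0
    and the bound is trivial.\<close>
  proof (cases "integrable lborel (\<lambda>t. D (z / of_real t) / of_real t * k t)")
    case True
    then show ?thesis
      unfolding H'_def ab by (rule integral_norm_bound_ennreal)
  qed (simp add: H'_def not_integrable_integral_eq)
  then have "(ennreal (cmod (H' z)))\<^sup>2 \<le> (\<integral>\<^sup>+t. a t * b t \<partial>lborel)\<^sup>2"
    by (rule power_mono) simp
  also have "\<dots> \<le> (\<integral>\<^sup>+t. (a t)\<^sup>2 \<partial>lborel) * (\<integral>\<^sup>+t. (b t)\<^sup>2 \<partial>lborel)"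
    by (rule Cauchy_Schwarz_nn_integral) (unfold a_def b_def, measurable)
  finally show ?thesis
    by (simp add: a2 b2 ennreal_power)
qed

text \<open>One factor of the squared mass of \<open>k\<close> comes from Cauchy-Schwarz; the other
  appears after Tonelli, since each dilate has the energy of \<open>f\<close>.\<close>

lemma H_energy_le:
  "dirichlet_energy H \<le> (\<integral>\<^sup>+t. ennreal (cmod (k t)) \<partial>lborel)\<^sup>2 * dirichlet_energy f"
proof -
  define M where "M = (\<integral>\<^sup>+t. ennreal (cmod (k t)) \<partial>lborel)"
  define d where "d z t = ennreal ((cmod (D (z / of_real t) / of_real t))\<^sup>2)" for z t
  have [measurable]: "(\<lambda>(z, t). d z t) \<in> borel_measurable (borel \<Otimes>\<^sub>M borel)"
    unfolding d_def by measurable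
  have "dirichlet_energy H \<le> (\<integral>\<^sup>+z. (\<integral>\<^sup>+t. ennreal (cmod (k t)) * d z t \<partial>lborel) * M \<partial>lborel)"
    unfolding dirichlet_energy_def
  proof (rule nn_integral_mono)
    fix z
    show "ennreal ((cmod (deriv H z))\<^sup>2) * indicator upper_half_plane z
        \<le> (\<integral>\<^sup>+t. ennreal (cmod (k t)) * d z t \<partial>lborel) * M"
    proof (cases "z \<in> upper_half_plane")
      case True
      then have "deriv H z = H' z"
        by (intro DERIV_imp_deriv H_has_derivative)
      then show ?thesis
        using True norm_H'_le[of z] by (simp add: M_def d_def)
    qed simp
  qed
  also have "\<dots> = (\<integral>\<^sup>+z. \<integral>\<^sup>+t. ennreal (cmod (k t)) * d z t \<partial>lborel \<partial>lborel) * M"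
    by (rule nn_integral_multc) measurable
  also have "(\<integral>\<^sup>+z. \<integral>\<^sup>+t. ennreal (cmod (k t)) * d z t \<partial>lborel \<partial>lborel)
      = (\<integral>\<^sup>+t. \<integral>\<^sup>+z. ennreal (cmod (k t)) * d z t \<partial>lborel \<partial>lborel)"
    by (rule lborel_pair.Fubini') measurable
  also have "\<dots> = (\<integral>\<^sup>+t. ennreal (cmod (k t)) * (\<integral>\<^sup>+z. d z t \<partial>lborel) \<partial>lborel)"
    by (intro nn_integral_cong nn_integral_cmult) measurable
  also have "\<dots> = (\<integral>\<^sup>+t. ennreal (cmod (k t)) * dirichlet_energy f \<partial>lborel)"
  proof (rule nn_integral_cong)
    fix t :: real
    show "ennreal (cmod (k t)) * (\<integral>\<^sup>+z. d z t \<partial>lborel) = ennreal (cmod (k t)) * dirichlet_energy f"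
      by (cases "0 < t") (simp_all add: d_def dilated_energy k_nonpos)
  qed
  also have "\<dots> = M * dirichlet_energy f"
    unfolding M_def by (rule nn_integral_multc) measurable
  finally show ?thesis
    by (simp add: M_def power2_eq_square mult_ac)
qed

end

subsection \<open>The Hausdorff operator\<close>

text \<open>Restrictions to an exhaustion of the half-line by compact intervals are measurable, and
  measurability passes to the pointwise limit.\<close>

lemma locally_integrable_pos_measurable:
  assumes "locally_integrable_pos \<phi>"
  shows "(\<lambda>t. indicator {0<..} t *\<^sub>R \<phi> t) \<in> borel_measurable lebesgue"
proof (rule borel_measurable_LIMSEQ_metric)
  \<comment> \<open>\<open>Suc n\<close> keeps the left endpoint positive even for
    \<open>n = 0\<close>, where the interval is empty.\<close>
  define K where "K n = {1 / real (Suc n)..real n}" for n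
  have K_pos: "0 < t" if "t \<in> K n" for t n
  proof -
    have "0 < 1 / real (Suc n)"
      by simp
    also have "\<dots> \<le> t"
      using that by (simp add: K_def)
    finally show ?thesis .
  qed
  show "(\<lambda>t. indicator (K n) t *\<^sub>R \<phi> t) \<in> borel_measurable lebesgue" for n
  proof -
    have "K n \<subseteq> {0<..}"
      using K_pos by auto
    then have "set_integrable lebesgue (K n) \<phi>"
      using assms by (simp add: locally_integrable_pos_def K_def)
    then show ?thesis
      unfolding set_integrable_def by (rule borel_measurable_integrable)
  qed
  show "(\<lambda>n. indicator (K n) t *\<^sub>R \<phi> t) \<longlonglongrightarrow> indicator {0<..} t *\<^sub>R \<phi> t" for t
  proof (cases "0 < t")
    case True
    have "\<forall>\<^sub>F n in sequentially. t \<in> K n"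
    proof -
      have "(\<lambda>n. 1 / real (Suc n)) \<longlonglongrightarrow> 0"
        by (rule LIMSEQ_Suc[OF lim_1_over_n])
      then have "\<forall>\<^sub>F n in sequentially. 1 / real (Suc n) < t"
        using True by (rule order_tendstoD(2))
      moreover have "\<forall>\<^sub>F n in sequentially. t \<le> real n"
        using filterlim_real_sequentially by (simp add: filterlim_at_top)
      ultimately show ?thesis
        by eventually_elim (simp add: K_def)
    qed
    then have "\<forall>\<^sub>F n in sequentially. indicator (K n) t *\<^sub>R \<phi> t = indicator {0<..} t *\<^sub>R \<phi> t"
      by eventually_elim (use True in simp)
    then show ?thesis
      by (rule tendsto_eventually)
  next
    case False
    then have "t \<notin> K n" for n
      using K_pos by blast
    then show ?thesis
      using False by simp
  qed
qed

text \<open>Supplies the Borel version of the weight required for joint measurability in Tonelli's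
  theorem.\<close>

lemma completion_ex_borel_measurable_complex:
  fixes g :: "'a \<Rightarrow> complex"
  assumes g: "g \<in> borel_measurable (completion M)"
  shows "\<exists>g'\<in>borel_measurable M. AE x in M. g x = g' x"
proof -
  note [measurable] = g
  have "(\<lambda>x. Re (g x)) \<in> borel_measurable (completion M)"
    by measurable
  then obtain u where [measurable]: "u \<in> borel_measurable M" and u: "AE x in M. Re (g x) = u x"
    by (blast dest: completion_ex_borel_measurable_real)
  have "(\<lambda>x. Im (g x)) \<in> borel_measurable (completion M)"
    by measurable
  then obtain v where [measurable]: "v \<in> borel_measurable M" and v: "AE x in M. Im (g x) = v x"
    by (blast dest: completion_ex_borel_measurable_real)
  show ?thesis
  proof
    show "(\<lambda>x. of_real (u x) + \<i> * of_real (v x)) \<in> borel_measurable M"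
      by measurable
    show "AE x in M. g x = of_real (u x) + \<i> * of_real (v x)"
      using u v by eventually_elim (simp add: complex_eq_iff)
  qed
qed

text \<open>Near \<open>t = 1\<close>, where \<open>ln\<close> vanishes, integrability comes from local integrability.\<close>
lemma hausdorff_weight_integrable:
  assumes loc: "locally_integrable_pos \<phi>"
    and log: "(\<integral>\<^sup>+ t\<in>{0<..}. ennreal (\<bar>ln t\<bar> / t * cmod (\<phi> t)) \<partial>lebesgue) < \<infinity>"
  defines "p \<equiv> \<lambda>t. (indicator {0<..} t *\<^sub>R \<phi> t) / of_real t"
  shows "integrable lebesgue p" and "integrable lebesgue (\<lambda>t. of_real (ln t) * p t)"
proof -
  have id: "(\<lambda>t. t) \<in> borel_measurable (lebesgue :: real measure)"
    by (rule measurable_completion) simp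
  have ln_lebesgue: "(\<lambda>t. ln t) \<in> borel_measurable (lebesgue :: real measure)"
    by (rule measurable_completion) simp
  note [measurable] = id ln_lebesgue locally_integrable_pos_measurable[OF loc]
  have p [measurable]: "p \<in> borel_measurable lebesgue"
    unfolding p_def by measurable
  show ln_int: "integrable lebesgue (\<lambda>t. of_real (ln t) * p t)"
  proof (rule integrableI_bounded)
    have "(\<integral>\<^sup>+t. ennreal (norm (of_real (ln t) * p t)) \<partial>lebesgue)
        = (\<integral>\<^sup>+ t\<in>{0<..}. ennreal (\<bar>ln t\<bar> / t * cmod (\<phi> t)) \<partial>lebesgue)"
      by (intro nn_integral_cong) (simp add: p_def indicator_def norm_mult norm_divide)
    with log show "(\<integral>\<^sup>+t. ennreal (norm (of_real (ln t) * p t)) \<partial>lebesgue) < \<infinity>"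
      by simp
  qed measurable
  define q where "q t = indicator {1/2..2} t *\<^sub>R \<phi> t" for t
  have q: "integrable lebesgue q"
  proof -
    have "set_integrable lebesgue {1/2..2} \<phi>"
      using loc unfolding locally_integrable_pos_def
      by (elim allE[of _ "{1/2..2}"]) (auto simp: subset_iff)
    then show ?thesis
      by (simp add: set_integrable_def q_def[abs_def])
  qed
  show "integrable lebesgue p"
  proof (rule Bochner_Integration.integrable_bound)
    \<comment> \<open>The constants come from \<open>1 / t \<le> 2\<close> on
      \<open>{1/2..2}\<close> and from \<open>\<bar>ln t\<bar> \<ge> ln 2\<close> on the rest of the
      half-line.\<close>
    show "integrable lebesgue (\<lambda>t. 2 * cmod (q t) + 1 / ln 2 * cmod (of_real (ln t) * p t))"
      by (intro Bochner_Integration.integrable_add integrable_mult_right integrable_norm q ln_int)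
    show "AE t in lebesgue. cmod (p t) \<le> norm (2 * cmod (q t) + 1 / ln 2 * cmod (of_real (ln t) * p t))"
    proof (rule AE_I2)
      fix t :: real
      have ln2: "0 < ln (2 :: real)"
        by simp
      have "cmod (p t) \<le> 2 * cmod (q t) + 1 / ln 2 * cmod (of_real (ln t) * p t)"
      proof (cases "t \<in> {1/2..2}")
        case True
        then have "cmod (\<phi> t) * 1 \<le> cmod (\<phi> t) * (2 * t)"
          by (intro mult_left_mono) auto
        with True have "cmod (p t) \<le> 2 * cmod (q t)"
          by (simp add: p_def q_def norm_divide divide_le_eq mult_ac)
        moreover have "0 \<le> 1 / ln 2 * cmod (of_real (ln t) * p t)"
          by simp
        ultimately show ?thesis
          by linarith
      next
        case False
        show ?thesis
        proof (cases "0 < t")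
          case True
          have "ln 2 \<le> \<bar>ln t\<bar>"
          proof (cases "t < 1")
            case True
            with \<open>0 < t\<close> False have "t \<le> 1 / 2"
              by auto
            with \<open>0 < t\<close> have "ln t \<le> ln (1 / 2)"
              by (subst ln_le_cancel_iff) auto
            then show ?thesis
              by (simp add: ln_div)
          next
            case False
            with \<open>t \<notin> {1/2..2}\<close> have "2 \<le> t"
              by auto
            then have "ln 2 \<le> ln t"
              by (subst ln_le_cancel_iff) auto
            then show ?thesis
              by simp
          qed
          then have "ln 2 * cmod (p t) \<le> \<bar>ln t\<bar> * cmod (p t)"
            by (rule mult_right_mono) simp
          then have "cmod (p t) \<le> 1 / ln 2 * cmod (of_real (ln t) * p t)"
            using ln2 by (simp add: norm_mult field_simps)
          then show ?thesis
            by (smt (verit) norm_ge_zero)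
        qed (use ln2 in \<open>simp add: p_def\<close>)
      qed
      then show "cmod (p t) \<le> norm (2 * cmod (q t) + 1 / ln 2 * cmod (of_real (ln t) * p t))"
        by simp
    qed
  qed measurable
qed

theorem theorem1p2:
  fixes \<phi> :: "real \<Rightarrow> complex"
  assumes "locally_integrable_pos \<phi>"
    and "(\<integral>\<^sup>+ t\<in>{0<..}. ennreal (\<bar>ln t\<bar> / t * cmod (\<phi> t)) \<partial>lebesgue) < \<infinity>"
  shows "hausdorff_bounded \<phi> \<and>
    operator_norm_on dirichlet_space dirichlet_norm (hausdorff_class \<phi>)
      \<le> (\<integral>\<^sup>+ t\<in>{0<..}. ennreal (cmod (\<phi> t) / t) \<partial>lebesgue)"
proof -
  define p where "p t = (indicator {0<..} t *\<^sub>R \<phi> t) / of_real t" for t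
  have p_int: "integrable lebesgue p" and ln_p_int: "integrable lebesgue (\<lambda>t. of_real (ln t) * p t)"
    unfolding p_def[abs_def] by (rule hausdorff_weight_integrable[OF assms])+
  have p [measurable]: "p \<in> borel_measurable lebesgue"
    using p_int by (rule borel_measurable_integrable)
  obtain k0 where k0 [measurable]: "k0 \<in> borel_measurable lborel" and "AE t in lborel. p t = k0 t"
    using completion_ex_borel_measurable_complex[OF p] by blast
  \<comment> \<open>The cutoff forces \<open>k\<close> to vanish at every nonpositive
    \<open>t\<close>, as the locale demands, and not merely almost everywhere.\<close>
  define k where "k t = indicator {0<..} t *\<^sub>R k0 t" for t
  have k [measurable]: "k \<in> borel_measurable lborel"
    unfolding k_def by measurable
  have "AE t in lborel. p t = k t"
    using \<open>AE t in lborel. p t = k0 t\<close>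
    by eventually_elim (auto simp: p_def k_def indicator_def)
  then have pk: "AE t in lebesgue. p t = k t"
    by (rule AE_completion)
  have k_int: "integrable lborel k"
  proof -
    have "integrable lebesgue k"
      using p_int measurable_completion[OF k] pk by (rule integrable_cong_AE_imp)
    then show ?thesis
      by (simp add: integrable_completion)
  qed
  have ln_k_int: "integrable lborel (\<lambda>t. of_real (ln t) * k t)"
  proof -
    have "(\<lambda>t. of_real (ln t) * k t) \<in> borel_measurable lebesgue"
      by (rule measurable_completion) measurable
    moreover have "AE t in lebesgue. of_real (ln t) * p t = of_real (ln t) * k t"
      using pk by eventually_elim simp
    ultimately have "integrable lebesgue (\<lambda>t. of_real (ln t) * k t)"
      by (rule integrable_cong_AE_imp[OF ln_p_int])
    then show ?thesis
      by (simp add: integrable_completion)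
  qed
  have loc: "dirichlet_dilation k f" if "f \<in> dirichlet_funs" for f
    using that k_int ln_k_int by unfold_locales (simp_all add: k_def)
  define M where "M = (\<integral>\<^sup>+t. ennreal (cmod (k t)) \<partial>lborel)"
  have M_eq: "(\<integral>\<^sup>+ t\<in>{0<..}. ennreal (cmod (\<phi> t) / t) \<partial>lebesgue) = M"
  proof -
    have "(\<integral>\<^sup>+ t\<in>{0<..}. ennreal (cmod (\<phi> t) / t) \<partial>lebesgue) = (\<integral>\<^sup>+t. ennreal (cmod (p t)) \<partial>lebesgue)"
      by (intro nn_integral_cong) (simp add: p_def indicator_def norm_divide)
    also have "\<dots> = (\<integral>\<^sup>+t. ennreal (cmod (k t)) \<partial>lebesgue)"
      by (rule nn_integral_cong_AE, use pk in eventually_elim) simp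
    finally show ?thesis
      by (simp add: M_def nn_integral_completion)
  qed
  \<comment> \<open>Finiteness is what lets \<open>enn2real M\<close> stand for \<open>M\<close> in
    the operator bound.\<close>
  have M_fin: "M < \<infinity>"
    using k_int by (simp add: M_def integrable_iff_bounded)

  have integrand: "(\<lambda>t. indicator {0<..} t *\<^sub>R hausdorff_integrand \<phi> f z t)
      = (\<lambda>t. dirichlet_dilation.F f (z / of_real t) * p t)"
    if f: "f \<in> dirichlet_funs" and z: "z \<in> upper_half_plane" for f z
  proof -
    interpret dirichlet_dilation k f
      using f by (rule loc)
    show ?thesis
      using divide_in_upper_half_plane[OF z]
      by (auto simp: fun_eq_iff F_def p_def hausdorff_integrand_def indicator_def)
  qed
  \<comment> \<open>The Lebesgue integral against \<open>p\<close> is transferred to the Borel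
    integral against \<open>k\<close> through their equality almost everywhere.\<close>
  have hausdorff: "set_integrable lebesgue {0<..} (hausdorff_integrand \<phi> f z)"
    "hausdorff \<phi> f z = dirichlet_dilation.H k f z"
    if f: "f \<in> dirichlet_funs" and z: "z \<in> upper_half_plane" for f z
  proof -
    interpret dirichlet_dilation k f
      using f by (rule loc)
    have F_lebesgue [measurable]: "(\<lambda>t. F (z / of_real t)) \<in> borel_measurable lebesgue"
      by (rule measurable_completion) measurable
    have Fk_borel: "(\<lambda>t. F (z / of_real t) * k t) \<in> borel_measurable lborel"
      by measurable
    have Fk_lebesgue: "(\<lambda>t. F (z / of_real t) * k t) \<in> borel_measurable lebesgue"
      using Fk_borel by (rule measurable_completion)
    have Fp_lebesgue: "(\<lambda>t. F (z / of_real t) * p t) \<in> borel_measurable lebesgue"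
      by measurable
    have eq: "AE t in lebesgue. F (z / of_real t) * k t = F (z / of_real t) * p t"
      using pk by eventually_elim simp
    have "integrable lebesgue (\<lambda>t. F (z / of_real t) * k t)"
      using integrable_F[OF z] Fk_borel by (simp add: integrable_completion)
    from this Fp_lebesgue eq have "integrable lebesgue (\<lambda>t. F (z / of_real t) * p t)"
      by (rule integrable_cong_AE_imp)
    then show "set_integrable lebesgue {0<..} (hausdorff_integrand \<phi> f z)"
      by (simp add: set_integrable_def integrand[OF f z])
    have "hausdorff \<phi> f z = (\<integral>t. F (z / of_real t) * p t \<partial>lebesgue)"
      by (simp add: hausdorff_def set_lebesgue_integral_def integrand[OF f z])
    also have "\<dots> = (\<integral>t. F (z / of_real t) * k t \<partial>lebesgue)"
      by (rule integral_cong_AE[OF Fp_lebesgue Fk_lebesgue], use pk in eventually_elim) simp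
    also have "\<dots> = H z"
      unfolding H_def by (rule integral_completion[OF Fk_borel])
    finally show "hausdorff \<phi> f z = H z" .
  qed

  have energy: "hausdorff \<phi> f \<in> dirichlet_funs \<and>
      dirichlet_seminorm (hausdorff \<phi> f) \<le> enn2real M * dirichlet_seminorm f"
    if f: "f \<in> dirichlet_funs" for f
  proof -
    interpret dirichlet_dilation k f
      using f by (rule loc)
    have "(hausdorff \<phi> f has_field_derivative H' z) (at z)" if z: "z \<in> upper_half_plane" for z
      using H_has_derivative[OF z] open_upper_half_plane z
      by (rule has_field_derivative_transform_within_open) (simp add: hausdorff(2)[OF f])
    note deriv = this
    have "hausdorff \<phi> f holomorphic_on upper_half_plane"
      using deriv open_upper_half_plane by (auto simp: holomorphic_on_open)
    moreover have "dirichlet_energy (hausdorff \<phi> f) = dirichlet_energy H"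
      unfolding dirichlet_energy_def
      by (intro nn_integral_cong)
        (simp add: indicator_def DERIV_imp_deriv[OF deriv] DERIV_imp_deriv[OF H_has_derivative])
    with H_energy_le have le: "dirichlet_energy (hausdorff \<phi> f) \<le> M\<^sup>2 * dirichlet_energy f"
      by (simp add: M_def)
    have fin: "dirichlet_energy f < \<infinity>"
      using f by (simp add: dirichlet_funs_def)
    \<comment> \<open>\<open>enn2real\<close> sends infinity to 0, so its monotonicity needs a
      finite upper bound.\<close>
    then have rhs: "M\<^sup>2 * dirichlet_energy f < \<infinity>"
      using M_fin by (simp add: ennreal_mult_less_top power2_eq_square)
    have "dirichlet_energy (hausdorff \<phi> f) < \<infinity>"
      using le rhs by (rule le_less_trans)
    moreover have "enn2real (dirichlet_energy (hausdorff \<phi> f)) \<le> (enn2real M)\<^sup>2 * enn2real (dirichlet_energy f)"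
      using enn2real_mono[OF le] rhs by (simp add: enn2real_mult power2_eq_square)
    then have "dirichlet_seminorm (hausdorff \<phi> f) \<le> enn2real M * dirichlet_seminorm f"
      unfolding dirichlet_seminorm_def
      by (metis enn2real_nonneg real_sqrt_le_mono real_sqrt_mult real_sqrt_abs abs_of_nonneg)
    ultimately show ?thesis
      by (simp add: dirichlet_funs_def)
  qed

  have resp: "(\<lambda>f. dirichlet_rel `` {hausdorff \<phi> f}) respects dirichlet_rel"
  proof (rule congruentI)
    fix f g assume fg: "(f, g) \<in> dirichlet_rel"
    then obtain c where f: "f \<in> dirichlet_funs" and g: "g \<in> dirichlet_funs"
        and c: "\<And>z. z \<in> upper_half_plane \<Longrightarrow> f z = g z + c"
      unfolding dirichlet_rel_iff by blast
    interpret f: dirichlet_dilation k f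
      using f by (rule loc)
    interpret g: dirichlet_dilation k g
      using g by (rule loc)
    \<comment> \<open>An additive constant \<open>c\<close> is multiplied by the total integral of
      \<open>k\<close>, hence remains a constant; this is why the operator descends to
      classes.\<close>
    have "hausdorff \<phi> f z = hausdorff \<phi> g z + c * (\<integral>t. k t \<partial>lborel)" if z: "z \<in> upper_half_plane" for z
    proof -
      have "f.F (z / of_real t) * k t = g.F (z / of_real t) * k t + c * k t" for t
        using c[OF f.divide_in_upper_half_plane[OF z, of t]] f.divide_in_upper_half_plane[OF z, of t]
        by (cases "0 < t") (simp_all add: f.F_def g.F_def f.k_nonpos algebra_simps)
      then have "f.H z = (\<integral>t. g.F (z / of_real t) * k t + c * k t \<partial>lborel)"
        by (simp add: f.H_def)
      also have "\<dots> = g.H z + c * (\<integral>t. k t \<partial>lborel)"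
        unfolding g.H_def
        by (subst Bochner_Integration.integral_add) (simp_all add: g.integrable_F z k_int)
      finally show ?thesis
        by (simp add: hausdorff(2) f g z)
    qed
    then have "(hausdorff \<phi> f, hausdorff \<phi> g) \<in> dirichlet_rel"
      unfolding dirichlet_rel_iff using energy f g by blast
    then show "dirichlet_rel `` {hausdorff \<phi> f} = dirichlet_rel `` {hausdorff \<phi> g}"
      by (rule equiv_class_eq[OF equiv_dirichlet_rel])
  qed
  have wd: "hausdorff_well_defined \<phi>"
    unfolding hausdorff_well_defined_def using resp hausdorff(1) by blast
  have maps: "hausdorff_class \<phi> \<in> dirichlet_space \<rightarrow> dirichlet_space"
  proof
    fix X assume "X \<in> dirichlet_space"
    then obtain f where "f \<in> dirichlet_funs" "X = dirichlet_rel `` {f}"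
      unfolding dirichlet_space_def by (elim quotientE)
    then show "hausdorff_class \<phi> X \<in> dirichlet_space"
      using energy by (simp add: hausdorff_class_class[OF wd] dirichlet_space_def quotientI)
  qed
  have "dirichlet_norm (hausdorff_class \<phi> X) \<le> enn2real M * dirichlet_norm X"
    if "X \<in> dirichlet_space" for X
  proof -
    obtain f where "f \<in> dirichlet_funs" "X = dirichlet_rel `` {f}"
      using \<open>X \<in> dirichlet_space\<close> unfolding dirichlet_space_def by (elim quotientE)
    then show ?thesis
      using energy by (simp add: hausdorff_class_class[OF wd] dirichlet_norm_class)
  qed
  \<comment> \<open>\<open>enn2real M\<close> is one of the admissible constants, so the infimum
    lies below it.\<close>
  then have "operator_norm_on dirichlet_space dirichlet_norm (hausdorff_class \<phi>) \<le> ennreal (enn2real M)"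
    unfolding operator_norm_on_def by (intro Inf_lower) auto
  then have norm: "operator_norm_on dirichlet_space dirichlet_norm (hausdorff_class \<phi>) \<le> M"
    using M_fin by simp
  then have "operator_norm_on dirichlet_space dirichlet_norm (hausdorff_class \<phi>) < \<infinity>"
    using M_fin by (rule le_less_trans)
  with wd maps norm show ?thesis
    by (simp add: hausdorff_bounded_def M_eq)
qed

end
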